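(* Let $\mathcal{P}$ be a finite-dimensional solvable Poisson algebra over a field $\mathbb{F}$, with nilradical $N$. Then $\mathcal{P}$ is $\phi$-free if and only if $\mathcal{P}=N\dot{+}U$ for some subalgebra $U$ of $\mathcal{P}$, where $\mathcal{P}_A^2=\mathcal{P}\cdot\mathcal{P}=0$ and $\mathcal{P}_L=(\mathcal{P},[\cdot,\cdot])$ is a $\phi_L$-free solvable Lie algebra. If moreover $\mathbb{F}$ has characteristic zero, then in such a decomposition (of a $\phi$-free $\mathcal{P}$) one has $U^2=U\cdot U+[U,U]=0$.
   Context: A Poisson algebra $(\mathcal{P},\cdot,[\cdot,\cdot])$ over $\mathbb{F}$ is a vector space with two bilinear products such that $(\mathcal{P},\cdot)$ is a commutative associative algebra (not necessarily unital), $(\mathcal{P},[\cdot,\cdot])$ is a Lie algebra, and $[x\cdot y,z]=[x,z]\cdot y+x\cdot[y,z]$ for all $x,y,z$. Products of subspaces are linear spans. A subalgebra is a subspace closed under both products; an ideal is a subspace $I$ with $I\cdot\mathcal{P}+[I,\mathcal{P}]\subseteq I$. A Poisson algebra $A$ is solvable if $A^{(m)}=0$ for some $m$, where $A^{(0)}=A$ and $A^{(n+1)}=A^{(n)}\cdot A^{(n)}+[A^{(n)},A^{(n)}]$; it is nilpotent if $A^m=0$ for some $m$, where $A^1=A$ and $A^{n+1}=\sum_{i=1}^{n}(A^i\cdot A^{n+1-i}+[A^i,A^{n+1-i}])$. The nilradical is the largest nilpotent ideal of $\mathcal{P}$. The Frattini subalgebra $F(\mathcal{P})$ is the intersection of the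 maximal (proper) subalgebras of $\mathcal{P}$, the Frattini ideal $\phi(\mathcal{P})$ is the largest ideal of $\mathcal{P}$ contained in $F(\mathcal{P})$, and $\mathcal{P}$ is $\phi$-free if $\phi(\mathcal{P})=0$. Similarly $\phi_L(\mathcal{P})$ is the largest Lie ideal of $\mathcal{P}_L$ contained in the intersection of the maximal Lie subalgebras of $\mathcal{P}_L$, and $\phi_L$-free means $\phi_L(\mathcal{P})=0$. The symbol $\dot{+}$ denotes a direct sum of underlying vector spaces. *)

theory Defs
  imports "HOL-Library.Set_Algebras" "HOL-Computational_Algebra.Computational_Algebra"
begin

text \<open>
  The algebra is the whole type \<open>'v\<close>, with scalar multiplication \<open>scale\<close>; subspaces,
  subalgebras and ideals are sets. Sums of subspaces are the elementwise sums of
  \<open>HOL-Library.Set_Algebras\<close>, also under \<open>\<Sum>\<close>.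
\<close>

context vector_space
begin

definition bilinear_op :: "('b \<Rightarrow> 'b \<Rightarrow> 'b) \<Rightarrow> bool" where
  "bilinear_op f \<longleftrightarrow>
    (\<forall>y. Vector_Spaces.linear scale scale (\<lambda>x. f x y)) \<and>
    (\<forall>x. Vector_Spaces.linear scale scale (\<lambda>y. f x y))"

definition set_product :: "('b \<Rightarrow> 'b \<Rightarrow> 'b) \<Rightarrow> 'b set \<Rightarrow> 'b set \<Rightarrow> 'b set" where
  "set_product f S T = span {f x y | x y. x \<in> S \<and> y \<in> T}"

end

locale lie_algebra = vector_space scale
  for scale :: "'f::field \<Rightarrow> 'v::ab_group_add \<Rightarrow> 'v" +
  fixes bracket :: "'v \<Rightarrow> 'v \<Rightarrow> 'v"
  assumes bilinear_bracket: "bilinear_op bracket"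
    and bracket_self: "bracket x x = 0"
    and jacobi: "bracket x (bracket y z) + bracket y (bracket z x) + bracket z (bracket x y) = 0"
begin

definition lie_subalgebra :: "'v set \<Rightarrow> bool" where
  "lie_subalgebra S \<longleftrightarrow> subspace S \<and> (\<forall>x\<in>S. \<forall>y\<in>S. bracket x y \<in> S)"

definition lie_ideal :: "'v set \<Rightarrow> bool" where
  "lie_ideal I \<longleftrightarrow> subspace I \<and> set_product bracket I UNIV \<subseteq> I"

definition maximal_lie_subalgebra :: "'v set \<Rightarrow> bool" where
  "maximal_lie_subalgebra M \<longleftrightarrow>
    lie_subalgebra M \<and> M \<noteq> UNIV \<and>
    (\<forall>S. lie_subalgebra S \<and> M \<subseteq> S \<longrightarrow> S = M \<or> S = UNIV)"

definition lie_frattini_subalgebra :: "'v set" where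
  "lie_frattini_subalgebra = \<Inter> {M. maximal_lie_subalgebra M}"

definition lie_frattini_ideal :: "'v set" where
  "lie_frattini_ideal = (GREATEST I. lie_ideal I \<and> I \<subseteq> lie_frattini_subalgebra)"

definition lie_phi_free :: bool where
  "lie_phi_free \<longleftrightarrow> lie_frattini_ideal = {0}"

primrec lie_derived :: "'v set \<Rightarrow> nat \<Rightarrow> 'v set" where
  "lie_derived A 0 = A"
| "lie_derived A (Suc n) = set_product bracket (lie_derived A n) (lie_derived A n)"

definition lie_solvable :: "'v set \<Rightarrow> bool" where
  "lie_solvable A \<longleftrightarrow> (\<exists>m. lie_derived A m = {0})"

end

locale poisson_algebra = lie_algebra scale bracket
  for scale :: "'f::field \<Rightarrow> 'v::ab_group_add \<Rightarrow> 'v"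
    and bracket :: "'v \<Rightarrow> 'v \<Rightarrow> 'v" +
  fixes mult :: "'v \<Rightarrow> 'v \<Rightarrow> 'v"
  assumes bilinear_mult: "bilinear_op mult"
    and mult_commute: "mult x y = mult y x"
    and mult_assoc: "mult (mult x y) z = mult x (mult y z)"
    and leibniz: "bracket (mult x y) z = mult (bracket x z) y + mult x (bracket y z)"
begin

definition poisson_product :: "'v set \<Rightarrow> 'v set \<Rightarrow> 'v set" where
  "poisson_product S T = set_product mult S T + set_product bracket S T"

definition subalgebra :: "'v set \<Rightarrow> bool" where
  "subalgebra S \<longleftrightarrow>
    subspace S \<and> (\<forall>x\<in>S. \<forall>y\<in>S. mult x y \<in> S \<and> bracket x y \<in> S)"

definition ideal :: "'v set \<Rightarrow> bool" where
  "ideal I \<longleftrightarrow> subspace I \<and> poisson_product I UNIV \<subseteq> I"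

definition maximal_subalgebra :: "'v set \<Rightarrow> bool" where
  "maximal_subalgebra M \<longleftrightarrow>
    subalgebra M \<and> M \<noteq> UNIV \<and>
    (\<forall>S. subalgebra S \<and> M \<subseteq> S \<longrightarrow> S = M \<or> S = UNIV)"

definition frattini_subalgebra :: "'v set" where
  "frattini_subalgebra = \<Inter> {M. maximal_subalgebra M}"

definition frattini_ideal :: "'v set" where
  "frattini_ideal = (GREATEST I. ideal I \<and> I \<subseteq> frattini_subalgebra)"

definition phi_free :: bool where
  "phi_free \<longleftrightarrow> frattini_ideal = {0}"

primrec derived :: "'v set \<Rightarrow> nat \<Rightarrow> 'v set" where
  "derived A 0 = A"
| "derived A (Suc n) = poisson_product (derived A n) (derived A n)"

definition solvable :: "'v set \<Rightarrow> bool" where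
  "solvable A \<longleftrightarrow> (\<exists>m. derived A m = {0})"

text \<open>Powers start at exponent 1; the value at exponent 0 is a dummy.\<close>

fun lower_power :: "'v set \<Rightarrow> nat \<Rightarrow> 'v set" where
  "lower_power A 0 = A"
| "lower_power A (Suc 0) = A"
| "lower_power A (Suc (Suc n)) =
    (\<Sum>i = 1..Suc n. poisson_product (lower_power A i) (lower_power A (Suc (Suc n) - i)))"

definition nilpotent :: "'v set \<Rightarrow> bool" where
  "nilpotent A \<longleftrightarrow> (\<exists>m\<ge>1. lower_power A m = {0})"

definition nilradical :: "'v set" where
  "nilradical = (GREATEST I. ideal I \<and> nilpotent I)"

end

end

theory Submission
  imports Defs
begin

text \<open>
  A \<open>\<phi>\<close>-free solvable Poisson algebra has zero associative product, so that the equivalence is a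
  statement about Lie algebras. Indeed solvability makes \<open>(P, \<cdot>)\<close> a nilpotent associative algebra:
  by associativity the \<open>2\<^sup>n\<close>-fold products lie in the \<open>n\<close>-th derived algebra. In a nilpotent
  algebra a set that generates modulo the square generates everything, hence the ideal
  \<open>P \<cdot> P\<close> lies in every maximal subalgebra
  (\<open>solvable_associative_square_subset_frattini\<close>), and \<open>\<phi>(P) = 0\<close> kills it. Once the product
  is zero, Poisson and Lie subalgebras, ideals, Frattini ideals and derived series coincide; this
  settles everything except the complement of the nilradical.

  The same principle, applied to a nilpotent ideal instead of \<open>P\<close>, shows that in a \<open>\<phi>\<close>-free
  algebra every nilpotent ideal has square zero. The nilradical \<open>N\<close> is therefore a square-zero
  ideal (\<open>phi_free_nilradical\<close>), and a subalgebra of least dimension among those that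
  supplement \<open>N\<close> is a complement (\<open>phi_free_square_zero_ideal_complemented\<close>).

  In characteristic zero the vanishing of \<open>[U, U]\<close> amounts to \<open>[P, P] \<subseteq> N\<close>, because
  \<open>[U, U] \<subseteq> U\<close> and \<open>N \<inter> U = 0\<close>. Over an algebraically closed field this would be Lie's
  theorem. The proof below works over any field of characteristic zero and rests on
  Jacobson's lemma (\<open>commutator_nilpotent\<close>): if \<open>[x, a]\<close> commutes with \<open>a\<close>, then it is nilpotent.
  Combined with the complete reducibility of \<open>N\<close> under the adjoint action, it shows that an
  ideal \<open>A\<close> with \<open>[A, A] \<subseteq> N\<close> is central modulo \<open>N\<close>, and that an ideal whose commutators are
  central modulo \<open>N\<close> has its commutators in \<open>N\<close>. These two facts carry centrality modulo \<open>N\<close>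
  up the derived series, from \<open>0\<close> to \<open>P\<close> (\<open>phi_free_solvable_derived_in_nilradical\<close>).
\<close>

section \<open>Subspaces and bilinear products\<close>

context vector_space
begin

lemma subspace_set_plus: "subspace S \<Longrightarrow> subspace T \<Longrightarrow> subspace (S + T)"
proof -
  have "S + T = {x + y | x y. x \<in> S \<and> y \<in> T}"
    by (auto simp: set_plus_def)
  then show "subspace S \<Longrightarrow> subspace T \<Longrightarrow> subspace (S + T)"
    using subspace_sums by simp
qed

lemma subset_set_plus_left: "subspace T \<Longrightarrow> S \<subseteq> S + T"
  using set_plus_intro[of _ S 0 T] by (force simp: subspace_0)

lemma subset_set_plus_right: "subspace S \<Longrightarrow> T \<subseteq> S + T"
  using set_plus_intro[of 0 S _ T] by (force simp: subspace_0)

lemma set_plus_subset: "subspace R \<Longrightarrow> S \<subseteq> R \<Longrightarrow> T \<subseteq> R \<Longrightarrow> S + T \<subseteq> R"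
  by (auto elim!: set_plus_elim intro: subspace_add)

lemma bilinear_opD:
  assumes "bilinear_op f"
  shows "f (x + y) z = f x z + f y z" "f z (x + y) = f z x + f z y"
    and "f (scale c x) z = scale c (f x z)" "f z (scale c x) = scale c (f z x)"
    and "f 0 z = 0" "f z 0 = 0"
    and "f (- x) z = - f x z" "f z (- x) = - f z x"
proof -
  interpret l: Vector_Spaces.linear scale scale "\<lambda>x. f x z"
    using assms by (simp add: bilinear_op_def)
  interpret r: Vector_Spaces.linear scale scale "\<lambda>x. f z x"
    using assms by (simp add: bilinear_op_def)
  show "f (x + y) z = f x z + f y z" "f z (x + y) = f z x + f z y"
    "f (scale c x) z = scale c (f x z)" "f z (scale c x) = scale c (f z x)"
    "f 0 z = 0" "f z 0 = 0" "f (- x) z = - f x z" "f z (- x) = - f z x"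
    by (fact l.add r.add l.scale r.scale l.zero r.zero l.neg r.neg)+
qed

lemma bilinear_op_span_left:
  assumes "bilinear_op f" "subspace R" "\<And>x. x \<in> X \<Longrightarrow> f x y \<in> R" "x \<in> span X"
  shows "f x y \<in> R"
proof -
  have "subspace {x. f x y \<in> R}"
    using assms(2) by (simp add: subspace_def bilinear_opD[OF assms(1)])
  then show ?thesis
    using span_minimal[of X "{x. f x y \<in> R}"] assms(3,4) by blast
qed

lemma bilinear_op_span_right:
  assumes "bilinear_op f" "subspace R" "\<And>y. y \<in> Y \<Longrightarrow> f x y \<in> R" "y \<in> span Y"
  shows "f x y \<in> R"
proof -
  have "subspace {y. f x y \<in> R}"
    using assms(2) by (simp add: subspace_def bilinear_opD[OF assms(1)])
  then show ?thesis
    using span_minimal[of Y "{y. f x y \<in> R}"] assms(3,4) by blast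
qed

lemma subspace_set_product: "subspace (set_product f S T)"
  by (simp add: set_product_def subspace_span)

lemma set_product_memI: "x \<in> S \<Longrightarrow> y \<in> T \<Longrightarrow> f x y \<in> set_product f S T"
  unfolding set_product_def by (intro span_base) blast

lemma set_product_subset:
  "subspace R \<Longrightarrow> (\<And>x y. x \<in> S \<Longrightarrow> y \<in> T \<Longrightarrow> f x y \<in> R) \<Longrightarrow> set_product f S T \<subseteq> R"
  unfolding set_product_def by (intro span_minimal) auto

text \<open>
  The argument that every generating set modulo the square of a nilpotent algebra generates
  it. Here \<open>N\<close> carries a family \<open>F\<close> of products that push the filtration \<open>T\<close> down to \<open>0\<close>,
  and \<open>generates\<close> says that \<open>S\<close> together with all products spans \<open>N\<close>. Expanding a product of
  two elements of \<open>S + T k\<close> leaves a product inside \<open>S\<close> and terms in \<open>T (Suc k)\<close>, so that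
  \<open>N \<subseteq> S + T k\<close> propagates to the next step of the filtration.
\<close>
lemma generates_modulo_square_imp_generates:
  assumes bilinear: "\<And>f. f \<in> F \<Longrightarrow> bilinear_op f"
    and S: "subspace S" "S \<subseteq> N" "\<And>f x y. f \<in> F \<Longrightarrow> x \<in> S \<Longrightarrow> y \<in> S \<Longrightarrow> f x y \<in> S"
    and T: "\<And>k. subspace (T k)" "\<And>k. T k \<subseteq> N" "N \<subseteq> T 0" "T m = {0}"
    and descent: "\<And>f x y k. f \<in> F \<Longrightarrow> x \<in> N \<Longrightarrow> y \<in> T k \<Longrightarrow>
      f x y \<in> T (Suc k) \<and> f y x \<in> T (Suc k)"
    and generates: "\<And>R. subspace R \<Longrightarrow> S \<subseteq> R \<Longrightarrow>
      (\<And>f x y. f \<in> F \<Longrightarrow> x \<in> N \<Longrightarrow> y \<in> N \<Longrightarrow> f x y \<in> R) \<Longrightarrow> N \<subseteq> R"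
  shows "N \<subseteq> S"
proof -
  have "N \<subseteq> S + T k" for k
  proof (induction k)
    case 0
    show ?case
      using T(3) subset_set_plus_right[OF S(1), of "T 0"] by blast
  next
    case (Suc k)
    show ?case
    proof (rule generates)
      show sub: "subspace (S + T (Suc k))"
        by (intro subspace_set_plus S(1) T(1))
      show "S \<subseteq> S + T (Suc k)"
        by (intro subset_set_plus_left T(1))
      fix f x y assume f: "f \<in> F" and "x \<in> N" "y \<in> N"
      then have "x \<in> S + T k" "y \<in> S + T k"
        using Suc by auto
      then obtain s t s' t' where st: "s \<in> S" "t \<in> T k" "s' \<in> S" "t' \<in> T k"
        and xy: "x = s + t" "y = s' + t'"
        by (elim set_plus_elim)
      have "f s t' + (f t s' + f t t') \<in> T (Suc k)"
        using descent[OF f] st S(2) T(2)[of k] by (intro subspace_add T(1)) auto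
      with S(3)[OF f st(1,3)] have "f s s' + (f s t' + (f t s' + f t t')) \<in> S + T (Suc k)"
        by (rule set_plus_intro)
      then show "f x y \<in> S + T (Suc k)"
        by (simp add: xy bilinear_opD[OF bilinear[OF f]] algebra_simps)
    qed
  qed
  from this[of m] show ?thesis
    by (simp add: T(4) set_plus_def)
qed

end

section \<open>Polynomials in a linear operator\<close>

text \<open>
  This is \<open>p(f) v\<close>. Horner's scheme is run on vectors because \<^const>\<open>poly\<close> needs its argument in
  the coefficient ring, and \<open>f\<close> is a function.
\<close>
definition (in vector_space) poly_op :: "('b \<Rightarrow> 'b) \<Rightarrow> 'a poly \<Rightarrow> 'b \<Rightarrow> 'b" where
  "poly_op f p v = fold_coeffs (\<lambda>a w. scale a v + f w) p 0"

context vector_space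
begin

lemma poly_op_0 [simp]: "poly_op f 0 v = 0"
  by (simp add: poly_op_def)

lemma poly_op_pCons:
  assumes "Vector_Spaces.linear scale scale f"
  shows "poly_op f (pCons a p) v = scale a v + f (poly_op f p v)"
proof -
  interpret f: Vector_Spaces.linear scale scale f by fact
  show ?thesis
    by (cases "p = 0"; cases "a = 0") (simp_all add: poly_op_def f.zero)
qed

lemma poly_op_add:
  assumes f: "Vector_Spaces.linear scale scale f"
  shows "poly_op f (p + q) v = poly_op f p v + poly_op f q v"
proof -
  interpret f: Vector_Spaces.linear scale scale f by fact
  show ?thesis
    by (induction p q rule: poly_induct2)
      (simp_all add: poly_op_pCons[OF f] f.add scale_left_distrib algebra_simps)
qed

lemma poly_op_smult:
  assumes f: "Vector_Spaces.linear scale scale f"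
  shows "poly_op f (smult c p) v = scale c (poly_op f p v)"
proof -
  interpret f: Vector_Spaces.linear scale scale f by fact
  show ?thesis
    by (induction p) (simp_all add: poly_op_pCons[OF f] f.scale scale_right_distrib)
qed

lemma poly_op_mult:
  assumes f: "Vector_Spaces.linear scale scale f"
  shows "poly_op f (p * q) v = poly_op f p (poly_op f q v)"
proof -
  interpret f: Vector_Spaces.linear scale scale f by fact
  show ?thesis
    by (induction p)
      (simp_all add: poly_op_pCons[OF f] poly_op_add[OF f] poly_op_smult[OF f])
qed

lemma poly_op_monom:
  assumes f: "Vector_Spaces.linear scale scale f"
  shows "poly_op f (monom c n) v = scale c ((f ^^ n) v)"
proof -
  interpret f: Vector_Spaces.linear scale scale f by fact
  show ?thesis
    by (induction n) (simp_all add: monom_0 monom_Suc poly_op_pCons[OF f] f.scale f.zero)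
qed

lemma poly_op_sum:
  assumes f: "Vector_Spaces.linear scale scale f"
  shows "poly_op f (\<Sum>i\<in>I. p i) v = (\<Sum>i\<in>I. poly_op f (p i) v)"
  by (induction I rule: infinite_finite_induct) (simp_all add: poly_op_add[OF f])

lemma subspace_kernel_poly_op:
  assumes f: "Vector_Spaces.linear scale scale f"
  shows "subspace {v. poly_op f p v = 0}"
proof -
  interpret f: Vector_Spaces.linear scale scale f by fact
  have add: "poly_op f p (u + v) = poly_op f p u + poly_op f p v" for u v
    by (induction p) (simp_all add: poly_op_pCons[OF f] f.add scale_right_distrib)
  have scale: "poly_op f p (scale c v) = scale c (poly_op f p v)" for c v
    by (induction p)
      (simp_all add: poly_op_pCons[OF f] f.scale scale_right_distrib scale_left_commute)
  have "poly_op f p 0 = 0"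
    using scale[of 0 0] by simp
  then show ?thesis
    by (simp add: subspace_def add scale)
qed

lemma poly_op_mem:
  assumes f: "Vector_Spaces.linear scale scale f"
    and W: "subspace W" "\<And>v. v \<in> W \<Longrightarrow> f v \<in> W" "v \<in> W"
  shows "poly_op f p v \<in> W"
  by (induction p) (use W in \<open>auto simp: poly_op_pCons[OF f] subspace_0 subspace_add subspace_scale\<close>)

lemma poly_op_commute:
  assumes f: "Vector_Spaces.linear scale scale f" and g: "Vector_Spaces.linear scale scale g"
    and W: "subspace W" "\<And>v. v \<in> W \<Longrightarrow> f v \<in> W"
    and commute: "\<And>v. v \<in> W \<Longrightarrow> f (g v) = g (f v)" and v: "v \<in> W"
  shows "poly_op f p (g v) = g (poly_op f p v)"
proof -
  interpret g: Vector_Spaces.linear scale scale g by fact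
  show ?thesis
    by (induction p)
      (simp_all add: poly_op_pCons[OF f] g.zero g.add g.scale commute poly_op_mem[OF f W v])
qed

text \<open>
  If \<open>c = [x, a]\<close> commutes with \<open>a\<close>, then commutation with \<open>x\<close> acts on polynomials in \<open>a\<close> as
  \<open>c\<close> times the formal derivative.
\<close>
lemma commutator_poly_op:
  assumes lin: "Vector_Spaces.linear scale scale a" "Vector_Spaces.linear scale scale x"
      "Vector_Spaces.linear scale scale c"
    and W: "subspace W" "\<And>v. v \<in> W \<Longrightarrow> a v \<in> W"
    and commutator: "\<And>v. v \<in> W \<Longrightarrow> x (a v) = a (x v) + c v"
    and commute: "\<And>v. v \<in> W \<Longrightarrow> a (c v) = c (a v)" and v: "v \<in> W"
  shows "x (poly_op a p v) = poly_op a p (x v) + poly_op a (pderiv p) (c v)"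
proof -
  interpret a: Vector_Spaces.linear scale scale a by fact
  interpret x: Vector_Spaces.linear scale scale x by fact
  have "c (poly_op a p v) = poly_op a p (c v)" for p
    using poly_op_commute[OF lin(1,3) W commute v] by simp
  then show ?thesis
    by (induction p)
      (simp_all add: poly_op_pCons[OF lin(1)] pderiv_pCons poly_op_add[OF lin(1)] x.zero x.add x.scale
        a.add commutator poly_op_mem[OF lin(1) W v] del: pderiv.simps)
qed

end

context finite_dimensional_vector_space
begin

lemma vector_annihilating_poly_exists:
  assumes f: "Vector_Spaces.linear scale scale f"
  shows "\<exists>p. p \<noteq> 0 \<and> poly_op f p v = 0"
proof (rule ccontr)
  assume "\<not> ?thesis"
  then have zero: "p = 0" if "poly_op f p v = 0" for p
    using that by blast
  let ?p = "\<lambda>i. (f ^^ i) v"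
  define d where "d = dimension"
  have inj: "inj ?p"
  proof (rule injI)
    fix i j assume "?p i = ?p j"
    then have "poly_op f (monom 1 i + monom (-1) j) v = 0"
      by (simp add: poly_op_add[OF f] poly_op_monom[OF f])
    then have "monom (1 :: 'a) i + monom (-1) j = 0"
      by (rule zero)
    then have "coeff (monom (1 :: 'a) i + monom (-1) j) i = 0"
      by simp
    then show "i = j"
      by (auto split: if_splits)
  qed
  \<comment> \<open>More powers than the dimension allows.\<close>
  have "independent (?p ` {..d})"
  proof (rule independent_if_scalars_zero)
    fix u y assume u: "(\<Sum>y\<in>?p ` {..d}. scale (u y) y) = 0" and "y \<in> ?p ` {..d}"
    then obtain i where i: "i \<le> d" "y = ?p i"
      by auto
    have "poly_op f (\<Sum>j\<le>d. monom (u (?p j)) j) v = 0"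
      using u by (simp add: poly_op_sum[OF f] poly_op_monom[OF f] sum.reindex inj_on_subset[OF inj])
    then have "(\<Sum>j\<le>d. monom (u (?p j)) j) = 0"
      by (rule zero)
    then have "coeff (\<Sum>j\<le>d. monom (u (?p j)) j) i = 0"
      by simp
    then show "u y = 0"
      using i by (simp add: coeff_sum)
  qed simp
  then have "card (?p ` {..d}) \<le> dimension"
    using independent_card_le_dim[OF subset_UNIV] dim_subset_UNIV le_trans by blast
  then show False
    by (simp add: card_image inj_on_subset[OF inj] d_def)
qed

lemma annihilating_poly_exists:
  assumes f: "Vector_Spaces.linear scale scale f"
  shows "\<exists>p. p \<noteq> 0 \<and> (\<forall>v. poly_op f p v = 0)"
proof -
  have "\<exists>p. p \<noteq> 0 \<and> (\<forall>v\<in>B. poly_op f p v = 0)" if "finite B" for B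
    using that
  proof (induction B rule: finite_induct)
    case (insert b B)
    then obtain p where p: "p \<noteq> 0" "\<forall>v\<in>B. poly_op f p v = 0"
      by blast
    obtain q where "q \<noteq> 0" "poly_op f q (poly_op f p b) = 0"
      using vector_annihilating_poly_exists[OF f] by blast
    moreover from this have "poly_op f q 0 = 0"
      using subspace_0[OF subspace_kernel_poly_op[OF f]] by blast
    ultimately show ?case
      using p by (intro exI[of _ "q * p"]) (simp add: poly_op_mult[OF f])
  qed (auto intro: exI[of _ 1])
  then obtain p where p: "p \<noteq> 0" "\<forall>v\<in>Basis. poly_op f p v = 0"
    using finite_Basis by blast
  then have "span Basis \<subseteq> {v. poly_op f p v = 0}"
    by (intro span_minimal subspace_kernel_poly_op f) auto
  then show ?thesis
    using p(1) span_Basis by blast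
qed

text \<open>
  Jacobson's lemma. Commuting an identity \<open>p(a) c\<^sup>k = 0\<close> with \<open>x\<close>, and multiplying by \<open>c\<^sup>k\<close>
  to remove the term with \<open>x\<close>, gives \<open>p'(a) c\<^bsup>2k+1\<^esup> = 0\<close>. In characteristic zero the
  derivative of a nonconstant polynomial is nonzero, so that descending on the degree turns
  an annihilating polynomial of \<open>a\<close> into a power of \<open>c\<close> that vanishes.
\<close>
lemma commutator_nilpotent:
  assumes char: "CHAR('a) = 0"
    and lin: "Vector_Spaces.linear scale scale a" "Vector_Spaces.linear scale scale x"
      "Vector_Spaces.linear scale scale c"
    and W: "subspace W" "\<And>v. v \<in> W \<Longrightarrow> a v \<in> W" "\<And>v. v \<in> W \<Longrightarrow> x v \<in> W" "\<And>v. v \<in> W \<Longrightarrow> c v \<in> W"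
    and commutator: "\<And>v. v \<in> W \<Longrightarrow> x (a v) = a (x v) + c v"
    and commute: "\<And>v. v \<in> W \<Longrightarrow> a (c v) = c (a v)"
  shows "\<exists>k. \<forall>v\<in>W. (c ^^ k) v = 0"
proof -
  interpret a: Vector_Spaces.linear scale scale a by fact
  interpret x: Vector_Spaces.linear scale scale x by fact
  interpret c: Vector_Spaces.linear scale scale c by fact
  have pow_mem: "(c ^^ k) v \<in> W" if "v \<in> W" for k v
    using that by (induction k) (auto intro: W(4))
  have pow_linear: "Vector_Spaces.linear scale scale (c ^^ k)" for k
  proof -
    have "(c ^^ k) (u + v) = (c ^^ k) u + (c ^^ k) v" for u v
      by (induction k) (simp_all add: c.add)
    moreover have "(c ^^ k) (scale b v) = scale b ((c ^^ k) v)" for v b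
      by (induction k) (simp_all add: c.scale)
    ultimately show ?thesis
      unfolding Vector_Spaces.linear_iff using vector_space_axioms by blast
  qed
  have pow_commute: "a ((c ^^ k) v) = (c ^^ k) (a v)" if "v \<in> W" for k v
    using that by (induction k) (simp_all add: commute pow_mem)
  have descend: "\<exists>m. \<forall>v\<in>W. (c ^^ m) v = 0"
    if "p \<noteq> 0" "\<forall>v\<in>W. poly_op a p ((c ^^ k) v) = 0" for p k
    using that
  proof (induction "degree p" arbitrary: p k rule: less_induct)
    case less
    show ?case
    proof (cases "degree p = 0")
      case True
      then obtain b where "p = [:b:]" "b \<noteq> 0"
        using less.prems(1) by (metis degree_eq_zeroE pCons_0_0)
      then show ?thesis
        using less.prems(2) by (auto simp: poly_op_pCons[OF lin(1)] a.zero)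
    next
      case False
      have "coeff (pderiv p) (degree p - 1) \<noteq> 0"
        using False char
        by (auto simp: coeff_pderiv of_nat_eq_0_iff_char_dvd simp del: of_nat_Suc)
      then have nz: "pderiv p \<noteq> 0"
        by auto
      have deg: "degree (pderiv p) < degree p"
        using False by (intro degree_lessI) (auto simp: coeff_pderiv coeff_eq_0)
      have "poly_op a (pderiv p) ((c ^^ (k + Suc k)) v) = 0" if v: "v \<in> W" for v
      proof -
        interpret ck: Vector_Spaces.linear scale scale "c ^^ k"
          by (rule pow_linear)
        let ?u = "(c ^^ k) v"
        have "poly_op a p (x ?u) + poly_op a (pderiv p) (c ?u) = 0"
          using commutator_poly_op[OF lin W(1,2) commutator commute pow_mem[OF v], of p k]
            less.prems(2) v by (simp add: x.zero)
        then have "(c ^^ k) (poly_op a p (x ?u)) + (c ^^ k) (poly_op a (pderiv p) (c ?u)) = 0"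
          by (metis ck.add ck.zero)
        moreover have "(c ^^ k) (poly_op a q w) = poly_op a q ((c ^^ k) w)" if "w \<in> W" for q w
          using poly_op_commute[OF lin(1) ck.linear_axioms W(1), of w q] W(2) pow_commute that
          by simp
        moreover have "(c ^^ (k + Suc k)) v = (c ^^ k) (c ?u)"
          by (simp only: funpow_add funpow.simps o_apply)
        ultimately show ?thesis
          using less.prems(2) v by (simp add: W pow_mem)
      qed
      then show ?thesis
        using less.hyps[OF deg nz] by blast
    qed
  qed
  obtain p where "p \<noteq> 0" "\<forall>v. poly_op a p v = 0"
    using annihilating_poly_exists[OF lin(1)] by blast
  then show ?thesis
    using descend[of p 0] by blast
qed

text \<open>
  On a minimal nonzero subspace stable under \<open>F\<close>, the kernel of each operator is stable and
  nonzero, hence everything.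
\<close>
lemma commuting_nilpotents_common_kernel:
  assumes lin: "\<And>f. f \<in> F \<Longrightarrow> Vector_Spaces.linear scale scale f"
    and V: "subspace V" "V \<noteq> {0}" "\<And>f v. f \<in> F \<Longrightarrow> v \<in> V \<Longrightarrow> f v \<in> V"
    and commute: "\<And>f g v. f \<in> F \<Longrightarrow> g \<in> F \<Longrightarrow> v \<in> V \<Longrightarrow> f (g v) = g (f v)"
    and nilpotent: "\<And>f. f \<in> F \<Longrightarrow> \<exists>k. \<forall>v\<in>V. (f ^^ k) v = 0"
  shows "\<exists>v\<in>V. v \<noteq> 0 \<and> (\<forall>f\<in>F. f v = 0)"
proof -
  define stable where
    "stable W \<longleftrightarrow> subspace W \<and> W \<subseteq> V \<and> W \<noteq> {0} \<and> (\<forall>f\<in>F. \<forall>v\<in>W. f v \<in> W)" for W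
  have "stable V"
    using V by (auto simp: stable_def)
  then obtain W where W: "stable W" and min: "\<And>W'. stable W' \<Longrightarrow> dim W \<le> dim W'"
    using ex_has_least_nat[of stable V dim] by blast
  have kernel: "f w = 0" if f: "f \<in> F" and w: "w \<in> W" for f w
  proof -
    interpret f: Vector_Spaces.linear scale scale f using lin[OF f] .
    let ?K = "{v \<in> W. f v = 0}"
    obtain w0 where w0: "w0 \<in> W" "w0 \<noteq> 0"
      using W subspace_0 unfolding stable_def by blast
    have pow: "(f ^^ k) w0 \<in> W" for k
      using W w0(1) f by (induction k) (auto simp: stable_def)
    obtain k where "(f ^^ k) w0 = 0"
      using nilpotent[OF f] W w0 by (auto simp: stable_def)
    then obtain j where "(f ^^ j) w0 \<noteq> 0" "(f ^^ Suc j) w0 = 0"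
      using w0(2) by (metis funpow_0 exists_least_lemma[of "\<lambda>k. (f ^^ k) w0 = 0"] )
    then have "(f ^^ j) w0 \<in> ?K" "(f ^^ j) w0 \<noteq> 0"
      using pow by auto
    then have "?K \<noteq> {0}"
      by blast
    moreover have "subspace ?K"
      using W by (auto simp: stable_def subspace_def f.add f.scale f.zero)
    moreover have "g v \<in> ?K" if "g \<in> F" "v \<in> ?K" for g v
    proof -
      have "f (g v) = g (f v)"
        using commute[OF f that(1)] W that(2) by (auto simp: stable_def)
      moreover have "g 0 = 0"
        using lin[OF that(1)] by (metis linear_iff_module_hom module_hom.zero)
      ultimately show ?thesis
        using W that by (auto simp: stable_def)
    qed
    ultimately have "stable ?K"
      using W by (auto simp: stable_def)
    then have "?K = W"
      using min W by (intro subspace_dim_equal) (auto simp: stable_def)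
    then show ?thesis
      using w by blast
  qed
  obtain w where "w \<in> W" "w \<noteq> 0"
    using W subspace_0 unfolding stable_def by blast
  then show ?thesis
    using kernel W by (auto simp: stable_def)
qed

end

section \<open>Ideals and subalgebras of Poisson algebras\<close>

context poisson_algebra
begin

lemmas mult_simps = bilinear_opD[OF bilinear_mult]
lemmas bracket_simps = bilinear_opD[OF bilinear_bracket]

lemma bracket_antisym: "bracket x y = - bracket y x"
proof -
  have "bracket (x + y) (x + y) = bracket x x + bracket y x + (bracket x y + bracket y y)"
    by (simp only: bracket_simps(1,2))
  then show ?thesis
    by (simp add: bracket_self eq_neg_iff_add_eq_0 add.commute)
qed

lemma jacobi_derivation: "bracket x (bracket y z) = bracket (bracket x y) z + bracket y (bracket x z)"
proof -
  have "bracket (bracket x y) z = - bracket z (bracket x y)"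
    by (rule bracket_antisym)
  moreover have "bracket y (bracket x z) = - bracket y (bracket z x)"
    by (simp add: bracket_antisym[of x z] bracket_simps)
  moreover have "bracket x (bracket y z) = - (bracket y (bracket z x) + bracket z (bracket x y))"
    using jacobi[of x y z] by (simp only: eq_neg_iff_add_eq_0 add.assoc)
  ultimately show ?thesis
    by simp
qed

lemma subspace_poisson_product: "subspace (poisson_product S T)"
  unfolding poisson_product_def by (intro subspace_set_plus subspace_set_product)

lemma poisson_product_memI:
  assumes "x \<in> S" "y \<in> T"
  shows "mult x y \<in> poisson_product S T" "bracket x y \<in> poisson_product S T"
  unfolding poisson_product_def
  using set_product_memI[OF assms] subset_set_plus_left[OF subspace_set_product]
    subset_set_plus_right[OF subspace_set_product] by blast+

lemma poisson_product_subset: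
  assumes "subspace R" "\<And>x y. x \<in> S \<Longrightarrow> y \<in> T \<Longrightarrow> mult x y \<in> R \<and> bracket x y \<in> R"
  shows "poisson_product S T \<subseteq> R"
  unfolding poisson_product_def
  using assms by (intro set_plus_subset set_product_subset) auto

lemma poisson_product_eq_zero_iff:
  "poisson_product S T = {0} \<longleftrightarrow> (\<forall>x\<in>S. \<forall>y\<in>T. mult x y = 0 \<and> bracket x y = 0)"
proof
  assume "\<forall>x\<in>S. \<forall>y\<in>T. mult x y = 0 \<and> bracket x y = 0"
  then have "poisson_product S T \<subseteq> {0}"
    by (intro poisson_product_subset) auto
  then show "poisson_product S T = {0}"
    using subspace_0[OF subspace_poisson_product] by blast
next
  assume "poisson_product S T = {0}"
  then show "\<forall>x\<in>S. \<forall>y\<in>T. mult x y = 0 \<and> bracket x y = 0"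
    using poisson_product_memI[of _ S _ T] by simp
qed

lemma ideal_iff:
  "ideal I \<longleftrightarrow> subspace I \<and> (\<forall>x\<in>I. \<forall>y. mult x y \<in> I \<and> bracket x y \<in> I)"
proof
  assume "ideal I"
  then show "subspace I \<and> (\<forall>x\<in>I. \<forall>y. mult x y \<in> I \<and> bracket x y \<in> I)"
    using poisson_product_memI[of _ I _ UNIV] by (auto simp: ideal_def)
next
  assume "subspace I \<and> (\<forall>x\<in>I. \<forall>y. mult x y \<in> I \<and> bracket x y \<in> I)"
  then show "ideal I"
    unfolding ideal_def by (intro conjI poisson_product_subset) auto
qed

lemma idealD:
  assumes "ideal I"
  shows "subspace I" "\<And>x y. x \<in> I \<Longrightarrow> mult x y \<in> I" "\<And>x y. x \<in> I \<Longrightarrow> mult y x \<in> I"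
    "\<And>x y. x \<in> I \<Longrightarrow> bracket x y \<in> I" "\<And>x y. x \<in> I \<Longrightarrow> bracket y x \<in> I"
proof -
  show I: "subspace I" "\<And>x y. x \<in> I \<Longrightarrow> mult x y \<in> I" "\<And>x y. x \<in> I \<Longrightarrow> bracket x y \<in> I"
    using assms by (auto simp: ideal_iff)
  show "mult y x \<in> I" if "x \<in> I" for x y
    using I(2)[OF that, of y] by (simp add: mult_commute)
  show "bracket y x \<in> I" if "x \<in> I" for x y
    using subspace_neg[OF I(1) I(3)[OF that, of y]] by (simp add: bracket_antisym[of y x])
qed

lemma subalgebraD:
  assumes "subalgebra S"
  shows "subspace S" "\<And>x y. x \<in> S \<Longrightarrow> y \<in> S \<Longrightarrow> mult x y \<in> S"
    "\<And>x y. x \<in> S \<Longrightarrow> y \<in> S \<Longrightarrow> bracket x y \<in> S"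
  using assms by (auto simp: subalgebra_def)

lemma ideal_Int_subalgebra: "ideal I \<Longrightarrow> subalgebra S \<Longrightarrow> subalgebra (I \<inter> S)"
  by (auto simp: subalgebra_def ideal_iff subspace_inter)

lemma ideal_set_plus:
  assumes "ideal I" "ideal J"
  shows "ideal (I + J)"
  unfolding ideal_iff using idealD[OF assms(1)] idealD[OF assms(2)]
  by (auto elim!: set_plus_elim intro!: subspace_set_plus set_plus_intro
      simp: mult_simps(1) bracket_simps(1))

lemma subalgebra_set_plus_ideal:
  assumes "ideal I" "subalgebra S"
  shows "subalgebra (I + S)"
  unfolding subalgebra_def
proof (intro conjI ballI)
  note I = idealD[OF assms(1)] and S = subalgebraD[OF assms(2)]
  show "subspace (I + S)"
    by (intro subspace_set_plus I S)
  fix x y assume "x \<in> I + S" "y \<in> I + S"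
  then obtain a s b t where xy: "x = a + s" "y = b + t" and mem: "a \<in> I" "s \<in> S" "b \<in> I" "t \<in> S"
    by (elim set_plus_elim)
  have "(mult a b + mult a t + mult s b) + mult s t \<in> I + S"
    using mem by (intro set_plus_intro I S subspace_add)
  then show "mult x y \<in> I + S"
    by (simp add: xy mult_simps(1,2) algebra_simps)
  have "(bracket a b + bracket a t + bracket s b) + bracket s t \<in> I + S"
    using mem by (intro set_plus_intro I S subspace_add)
  then show "bracket x y \<in> I + S"
    by (simp add: xy bracket_simps(1,2) algebra_simps)
qed

text \<open>
  The only mixed term that is not immediate is \<open>[x, y] \<cdot> z\<close>; the Leibniz rule rewrites it as
  \<open>[x \<cdot> z, y] - x \<cdot> [z, y]\<close>, whose factors stay in \<open>I\<close>.
\<close>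
lemma ideal_poisson_square:
  assumes "ideal I"
  shows "ideal (poisson_product I I)"
proof -
  note I = idealD[OF assms]
  let ?Q = "poisson_product I I"
  have sub: "subspace ?Q"
    by (rule subspace_poisson_product)
  have gen: "mult (mult x y) z \<in> ?Q \<and> bracket (mult x y) z \<in> ?Q \<and>
      mult (bracket x y) z \<in> ?Q \<and> bracket (bracket x y) z \<in> ?Q" if "x \<in> I" "y \<in> I" for x y z
  proof (intro conjI)
    show "mult (mult x y) z \<in> ?Q"
      using that I by (simp add: mult_assoc poisson_product_memI)
    show "bracket (mult x y) z \<in> ?Q"
      using that I by (simp add: leibniz poisson_product_memI subspace_add[OF sub])
    have "mult (bracket x y) z = bracket (mult x z) y - mult x (bracket z y)"
      by (simp add: leibniz)
    then show "mult (bracket x y) z \<in> ?Q"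
      using that I by (simp add: poisson_product_memI subspace_diff[OF sub])
    have "bracket (bracket x y) z = bracket x (bracket y z) - bracket y (bracket x z)"
      by (simp add: jacobi_derivation[of x y z])
    then show "bracket (bracket x y) z \<in> ?Q"
      using that I by (simp add: poisson_product_memI subspace_diff[OF sub])
  qed
  have "?Q \<subseteq> {q. \<forall>z. mult q z \<in> ?Q \<and> bracket q z \<in> ?Q}"
  proof (rule poisson_product_subset)
    show "subspace {q. \<forall>z. mult q z \<in> ?Q \<and> bracket q z \<in> ?Q}"
      using sub by (auto simp: subspace_def mult_simps bracket_simps)
  qed (use gen in blast)
  then show ?thesis
    using sub by (auto simp: ideal_iff)
qed

lemma ideal_associative_square: "ideal (set_product mult UNIV UNIV)"
proof -
  let ?Q = "set_product mult UNIV UNIV"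
  have sub: "subspace ?Q"
    by (rule subspace_set_product)
  have "bracket q z \<in> ?Q" if "q \<in> ?Q" for q z
  proof (rule bilinear_op_span_left[OF bilinear_bracket sub])
    show "q \<in> span {mult x y | x y. x \<in> UNIV \<and> y \<in> UNIV}"
      using that by (simp add: set_product_def)
  qed (auto simp: leibniz intro!: subspace_add[OF sub] set_product_memI)
  then show ?thesis
    using sub by (auto simp: ideal_iff intro: set_product_memI)
qed

section \<open>The Frattini ideal\<close>

lemma maximal_subalgebra_supplement:
  assumes "maximal_subalgebra M" "ideal I" "\<not> I \<subseteq> M"
  shows "I + M = UNIV"
proof -
  have M: "subalgebra M" "\<And>S. subalgebra S \<Longrightarrow> M \<subseteq> S \<Longrightarrow> S = M \<or> S = UNIV"
    using assms(1) by (auto simp: maximal_subalgebra_def)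
  have "M \<subseteq> I + M" "I \<subseteq> I + M"
    using subset_set_plus_right[of I M] subset_set_plus_left[of M I]
      idealD(1)[OF assms(2)] subalgebraD(1)[OF M(1)] by auto
  then show ?thesis
    using M(2)[OF subalgebra_set_plus_ideal[OF assms(2) M(1)]] assms(3) by blast
qed

lemma subspace_frattini_subalgebra: "subspace frattini_subalgebra"
  unfolding frattini_subalgebra_def
  by (intro subspace_Inter) (auto simp: maximal_subalgebra_def subalgebra_def)

text \<open>
  The span of all ideals inside the Frattini subalgebra is the largest of them, so the
  Frattini ideal is indeed a greatest element.
\<close>
lemma phi_free_imp_ideal_zero:
  assumes "phi_free" "ideal I" "I \<subseteq> frattini_subalgebra"
  shows "I = {0}"
proof -
  let ?P = "\<lambda>I. ideal I \<and> I \<subseteq> frattini_subalgebra"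
  let ?G = "span (\<Union>{I. ?P I})"
  have gen: "mult x y \<in> ?G" "bracket x y \<in> ?G" if x: "x \<in> \<Union>{I. ?P I}" for x y
  proof -
    obtain J where J: "?P J" "x \<in> J"
      using x by blast
    then have "mult x y \<in> J" "bracket x y \<in> J"
      using idealD(2,4) by auto
    then show "mult x y \<in> ?G" "bracket x y \<in> ?G"
      using J(1) by (auto intro!: span_base)
  qed
  have "mult x y \<in> ?G" if "x \<in> ?G" for x y
    using bilinear_op_span_left[OF bilinear_mult subspace_span gen(1) that] .
  moreover have "bracket x y \<in> ?G" if "x \<in> ?G" for x y
    using bilinear_op_span_left[OF bilinear_bracket subspace_span gen(2) that] .
  ultimately have "ideal ?G"
    by (simp add: ideal_iff subspace_span)
  moreover have "?G \<subseteq> frattini_subalgebra"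
    by (intro span_minimal subspace_frattini_subalgebra) blast
  moreover have upper: "J \<subseteq> ?G" if "?P J" for J
    using that span_superset[of "\<Union>{I. ?P I}"] by blast
  ultimately have "frattini_ideal = ?G"
    unfolding frattini_ideal_def by (intro Greatest_equality) auto
  then have "I \<subseteq> {0}"
    using upper assms by (auto simp: phi_free_def)
  then show ?thesis
    using idealD(1)[OF assms(2)] subspace_0 by blast
qed

section \<open>Associative products vanish\<close>

primrec associative_power :: "nat \<Rightarrow> 'v set" where
  "associative_power 0 = UNIV"
| "associative_power (Suc n) = set_product mult (associative_power n) UNIV"

lemma subspace_associative_power: "subspace (associative_power n)"
  by (cases n) (simp_all add: subspace_set_product)

lemma associative_power_add:
  "associative_power (Suc (i + j)) \<subseteq> set_product mult (associative_power i) (associative_power j)"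
proof (induction j)
  case (Suc j)
  let ?R = "set_product mult (associative_power i) (associative_power (Suc j))"
  have "mult x y \<in> ?R" if "x \<in> associative_power (Suc (i + j))" for x y
  proof (rule bilinear_op_span_left[OF bilinear_mult subspace_set_product])
    show "x \<in> span {mult x y | x y. x \<in> associative_power i \<and> y \<in> associative_power j}"
      using that Suc by (auto simp: set_product_def)
    fix z assume "z \<in> {mult x y | x y. x \<in> associative_power i \<and> y \<in> associative_power j}"
    then obtain a b where "a \<in> associative_power i" "b \<in> associative_power j" "z = mult a b"
      by blast
    then show "mult z y \<in> ?R"
      unfolding associative_power.simps
      by (simp only: mult_assoc) (intro set_product_memI UNIV_I)
  qed
  then show ?case
    by (simp only: add_Suc_right associative_power.simps(2)[of "Suc (i + j)"])
      (intro set_product_subset subspace_set_product)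
qed simp

text \<open>
  Since \<open>associative_power n\<close> consists of the \<open>(n + 1)\<close>-fold products, associativity puts the
  \<open>2\<^sup>n\<close>-fold products into the \<open>n\<close>-th derived algebra.
\<close>
lemma associative_power_subset_derived: "associative_power (2 ^ n - 1) \<subseteq> derived UNIV n"
proof (induction n)
  case (Suc n)
  have "(2 :: nat) ^ Suc n - 1 = Suc ((2 ^ n - 1) + (2 ^ n - 1))"
    using one_le_power[of "2 :: nat" n] by (simp only: power_Suc) linarith
  then have "associative_power (2 ^ Suc n - 1) \<subseteq>
      set_product mult (associative_power (2 ^ n - 1)) (associative_power (2 ^ n - 1))"
    by (metis associative_power_add)
  also have "\<dots> \<subseteq> derived UNIV (Suc n)"
    unfolding derived.simps using Suc
    by (intro set_product_subset subspace_poisson_product poisson_product_memI(1)) auto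
  finally show ?case .
qed simp

text \<open>
  A maximal subalgebra missing \<open>P \<cdot> P\<close> would generate \<open>P\<close> modulo \<open>P \<cdot> P\<close>, hence all of the
  nilpotent associative algebra \<open>P\<close>.
\<close>
lemma solvable_associative_square_subset_frattini:
  assumes "solvable UNIV"
  shows "set_product mult UNIV UNIV \<subseteq> frattini_subalgebra"
proof -
  have "set_product mult UNIV UNIV \<subseteq> M" if M: "maximal_subalgebra M" for M
  proof (rule ccontr)
    assume "\<not> set_product mult UNIV UNIV \<subseteq> M"
    then have supplement: "set_product mult UNIV UNIV + M = UNIV"
      using maximal_subalgebra_supplement[OF M ideal_associative_square] by blast
    note M' = subalgebraD[of M]
    obtain n where "derived UNIV n = {0}"
      using assms by (auto simp: solvable_def)
    then have zero: "associative_power (2 ^ n - 1) = {0}"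
      using associative_power_subset_derived[of n] subspace_0[OF subspace_associative_power] by blast
    have "UNIV \<subseteq> M"
    proof (rule generates_modulo_square_imp_generates[where F = "{mult}" and T = associative_power,
          OF _ _ _ _ _ _ _ zero])
      show "UNIV \<subseteq> R" if "subspace R" "M \<subseteq> R"
        "\<And>f x y. f \<in> {mult} \<Longrightarrow> x \<in> UNIV \<Longrightarrow> y \<in> UNIV \<Longrightarrow> f x y \<in> R" for R
        using set_plus_subset[OF that(1) set_product_subset[OF that(1)] that(2)] that(3) supplement
        by (metis UNIV_I singletonI)
      show "f x y \<in> associative_power (Suc k) \<and> f y x \<in> associative_power (Suc k)"
        if "f \<in> {mult}" "y \<in> associative_power k" for f x y k
        using that set_product_memI[of y "associative_power k" x UNIV mult] mult_commute[of x y]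
        by simp
    qed (use M in \<open>auto simp: bilinear_mult subspace_associative_power maximal_subalgebra_def
        subalgebra_def\<close>)
    then show False
      using M by (auto simp: maximal_subalgebra_def)
  qed
  then show ?thesis
    by (auto simp: frattini_subalgebra_def)
qed

lemma phi_free_solvable_imp_mult_zero:
  assumes "phi_free" "solvable UNIV"
  shows "mult x y = 0"
  using phi_free_imp_ideal_zero[OF assms(1) ideal_associative_square
      solvable_associative_square_subset_frattini[OF assms(2)]] set_product_memI[of x UNIV y UNIV mult]
  by simp

lemma mult_zero_imp_notions_agree:
  assumes zero: "\<And>x y. mult x y = 0"
  shows "phi_free \<longleftrightarrow> lie_phi_free" "solvable A \<longleftrightarrow> lie_solvable A"
proof -
  have prod: "poisson_product S T = set_product bracket S T" for S T
  proof -
    have "set_product mult S T \<subseteq> {0}"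
      by (intro set_product_subset) (simp_all add: zero)
    then have "set_product mult S T = {0}"
      using subspace_0[OF subspace_set_product] by blast
    then show ?thesis
      by (simp add: poisson_product_def)
  qed
  have "subalgebra = lie_subalgebra"
    by (auto simp: fun_eq_iff subalgebra_def lie_subalgebra_def zero subspace_0)
  moreover have "ideal = lie_ideal"
    by (auto simp: fun_eq_iff ideal_def lie_ideal_def prod)
  ultimately show "phi_free \<longleftrightarrow> lie_phi_free"
    by (simp add: phi_free_def lie_phi_free_def frattini_ideal_def lie_frattini_ideal_def
        frattini_subalgebra_def lie_frattini_subalgebra_def maximal_subalgebra_def
        maximal_lie_subalgebra_def)
  have "derived A n = lie_derived A n" for n
    by (induction n) (simp_all add: prod)
  then show "solvable A \<longleftrightarrow> lie_solvable A"
    by (simp add: solvable_def lie_solvable_def)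
qed

section \<open>Nilpotent ideals\<close>

lemma subspace_sum_poisson_products:
  fixes I :: "nat set"
  shows "subspace (\<Sum>i\<in>I. poisson_product (B i) (C i))"
  by (induction I rule: infinite_finite_induct)
    (auto intro: subspace_set_plus subspace_poisson_product simp: set_zero)

lemma poisson_product_subset_lower_power:
  assumes "1 \<le> i" "i \<le> Suc n"
  shows "poisson_product (lower_power A i) (lower_power A (Suc (Suc n) - i))
    \<subseteq> lower_power A (Suc (Suc n))"
proof -
  let ?f = "\<lambda>i. poisson_product (lower_power A i) (lower_power A (Suc (Suc n) - i))"
  have "?f i \<subseteq> ?f i + (\<Sum>j\<in>{1..Suc n} - {i}. ?f j)"
    by (rule subset_set_plus_left[OF subspace_sum_poisson_products])
  also have "\<dots> = (\<Sum>j\<in>{1..Suc n}. ?f j)"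
    using assms by (intro sum.remove[symmetric]) auto
  finally show ?thesis
    by (simp only: lower_power.simps)
qed

lemma subspace_lower_power:
  assumes "subspace A"
  shows "subspace (lower_power A n)"
  using assms by (induction A n rule: lower_power.induct)
    (simp_all only: lower_power.simps subspace_sum_poisson_products)

lemma lower_power_subset:
  assumes "subspace R"
    and "\<And>i x y. 1 \<le> i \<Longrightarrow> i \<le> Suc n \<Longrightarrow> x \<in> lower_power A i \<Longrightarrow>
      y \<in> lower_power A (Suc (Suc n) - i) \<Longrightarrow> mult x y \<in> R \<and> bracket x y \<in> R"
  shows "lower_power A (Suc (Suc n)) \<subseteq> R"
proof -
  have "(\<Sum>i\<in>I. poisson_product (lower_power A i) (lower_power A (Suc (Suc n) - i))) \<subseteq> R"
    if "I \<subseteq> {1..Suc n}" for I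
    using finite_subset[OF that finite_atLeastAtMost] that
  proof (induction I rule: finite_induct)
    case (insert i I)
    have "poisson_product (lower_power A i) (lower_power A (Suc (Suc n) - i)) \<subseteq> R"
      by (intro poisson_product_subset assms) (use insert.prems in auto)
    with insert show ?case
      by (simp only: sum.insert insert_subset set_plus_subset[OF assms(1)] simp_thms)
  qed (use subspace_0[OF assms(1)] in \<open>simp add: set_zero\<close>)
  then show ?thesis
    by (simp only: lower_power.simps subset_refl)
qed

lemma lower_power_subset_ideal:
  assumes "ideal I"
  shows "lower_power I n \<subseteq> I"
proof (induction n rule: less_induct)
  case (less n)
  show ?case
  proof (cases "(I, n)" rule: lower_power.cases)
    case (3 A m)
    have "lower_power I (Suc (Suc m)) \<subseteq> I"
    proof (rule lower_power_subset[OF idealD(1)[OF assms]])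
      fix i x y assume "1 \<le> i" "i \<le> Suc m" "x \<in> lower_power I i"
      then have "x \<in> I"
        using less[of i] 3 by auto
      then show "mult x y \<in> I \<and> bracket x y \<in> I"
        using idealD[OF assms] by blast
    qed
    with 3 show ?thesis
      by simp
  qed auto
qed

text \<open>
  Nilpotency against maximal subalgebras: a maximal subalgebra \<open>M\<close> that misses the square of
  \<open>N\<close> supplements it, so \<open>N \<inter> M\<close> generates \<open>N\<close> modulo its square and hence equals \<open>N\<close>.
\<close>
lemma nilpotent_ideal_square_subset_frattini:
  assumes N: "ideal N" "nilpotent N"
  shows "poisson_product N N \<subseteq> frattini_subalgebra"
proof -
  note N' = idealD[OF N(1)]
  have square: "poisson_product N N \<subseteq> N"
    using N' by (intro poisson_product_subset) auto
  obtain m where "m \<ge> 1" "lower_power N m = {0}"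
    using N(2) by (auto simp: nilpotent_def)
  then have zero: "lower_power N (Suc (m - 1)) = {0}"
    by simp
  have "poisson_product N N \<subseteq> M" if M: "maximal_subalgebra M" for M
  proof (rule ccontr)
    assume missed: "\<not> poisson_product N N \<subseteq> M"
    then have supplement: "poisson_product N N + M = UNIV"
      using maximal_subalgebra_supplement[OF M ideal_poisson_square[OF N(1)]] by blast
    have M': "subalgebra (N \<inter> M)"
      using M ideal_Int_subalgebra[OF N(1)] by (auto simp: maximal_subalgebra_def)
    have "N \<subseteq> N \<inter> M"
    proof (rule generates_modulo_square_imp_generates[where F = "{mult, bracket}" and
          T = "\<lambda>k. lower_power N (Suc k)", OF _ _ _ _ _ _ _ zero])
      show "N \<subseteq> R" if R: "subspace R" "N \<inter> M \<subseteq> R"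
        "\<And>f x y. f \<in> {mult, bracket} \<Longrightarrow> x \<in> N \<Longrightarrow> y \<in> N \<Longrightarrow> f x y \<in> R" for R
      proof
        fix n assume n: "n \<in> N"
        obtain q z where qz: "n = q + z" "q \<in> poisson_product N N" "z \<in> M"
          using supplement by (metis UNIV_I set_plus_elim)
        moreover have "poisson_product N N \<subseteq> R"
          using R by (intro poisson_product_subset) auto
        moreover have "z = n - q"
          using qz(1) by simp
        then have "z \<in> N"
          using n qz(2) square N'(1) by (auto intro: subspace_diff)
        ultimately show "n \<in> R"
          using R(1,2) by (auto intro: subspace_add)
      qed
      show "f x y \<in> lower_power N (Suc (Suc k)) \<and> f y x \<in> lower_power N (Suc (Suc k))"
        if "f \<in> {mult, bracket}" "x \<in> N" "y \<in> lower_power N (Suc k)" for f x y k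
      proof -
        have "f x y \<in> poisson_product N (lower_power N (Suc k))"
          "f y x \<in> poisson_product (lower_power N (Suc k)) N"
          using that poisson_product_memI[of x N y] poisson_product_memI[of y _ x N] by auto
        then show ?thesis
          using poisson_product_subset_lower_power[of 1 k N]
            poisson_product_subset_lower_power[of "Suc k" k N]
          by (simp add: subset_iff del: lower_power.simps(3))
      qed
      show "bilinear_op f" if "f \<in> {mult, bracket}" for f
        using that bilinear_mult bilinear_bracket by blast
      show "f x y \<in> N \<inter> M" if "f \<in> {mult, bracket}" "x \<in> N \<inter> M" "y \<in> N \<inter> M" for f x y
        using that subalgebraD(2,3)[OF M'] by blast
    qed (use subalgebraD(1)[OF M'] lower_power_subset_ideal[OF N(1)] subspace_lower_power[OF N'(1)] in
        \<open>simp_all del: lower_power.simps(3)\<close>)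
    then show False
      using square missed by blast
  qed
  then show ?thesis
    by (auto simp: frattini_subalgebra_def)
qed

lemma phi_free_nilpotent_ideal_square_zero:
  assumes "phi_free" "ideal N" "nilpotent N"
  shows "poisson_product N N = {0}"
  using assms ideal_poisson_square nilpotent_ideal_square_subset_frattini phi_free_imp_ideal_zero
  by blast

lemma cube_zero_imp_nilpotent:
  assumes I: "ideal I"
    and cube: "\<And>x y. x \<in> I \<Longrightarrow> y \<in> poisson_product I I \<Longrightarrow> mult x y = 0 \<and> bracket x y = 0"
  shows "nilpotent I"
proof -
  have "lower_power I 2 \<subseteq> poisson_product I I"
    unfolding numeral_2_eq_2
  proof (rule lower_power_subset[OF subspace_poisson_product])
    fix i x y assume "1 \<le> i" "i \<le> Suc 0" "x \<in> lower_power I i" "y \<in> lower_power I (Suc (Suc 0) - i)"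
    moreover from this have "i = Suc 0"
      by simp
    ultimately have "x \<in> I" "y \<in> I"
      by simp_all
    then show "mult x y \<in> poisson_product I I \<and> bracket x y \<in> poisson_product I I"
      by (simp add: poisson_product_memI)
  qed
  then have two: "y \<in> poisson_product I I" if "y \<in> lower_power I (Suc (Suc 0))" for y
    using that by (auto simp: numeral_2_eq_2 simp del: lower_power.simps(3))
  have "lower_power I 3 \<subseteq> {0}"
    unfolding numeral_3_eq_3
  proof (rule lower_power_subset[OF subspace_single_0])
    fix i x y assume i: "1 \<le> i" "i \<le> Suc (Suc 0)"
      and x: "x \<in> lower_power I i" and y: "y \<in> lower_power I (Suc (Suc (Suc 0)) - i)"
    consider "i = Suc 0" | "i = Suc (Suc 0)"
      using i by linarith
    then show "mult x y \<in> {0} \<and> bracket x y \<in> {0}"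
    proof cases
      case 1
      then show ?thesis
        using x y cube two by (simp del: lower_power.simps(3))
    next
      case 2
      then have "mult y x = 0" "bracket y x = 0"
        using x y cube two by (simp_all del: lower_power.simps(3))
      then show ?thesis
        by (simp add: mult_commute[of x y] bracket_antisym[of x y])
    qed
  qed
  then have "lower_power I 3 = {0}"
    using subspace_0[OF subspace_lower_power[OF idealD(1)[OF I]]] by blast
  then show ?thesis
    unfolding nilpotent_def by (intro exI[of _ 3]) simp
qed

text \<open>
  The nonzero terms of a product in \<open>A + B\<close> have one factor in each ideal, so they lie in
  \<open>A \<inter> B\<close>, which both \<open>A\<close> and \<open>B\<close> annihilate: the cube of \<open>A + B\<close> is zero.
\<close>
lemma sum_of_square_zero_ideals_nilpotent:
  assumes "ideal A" "ideal B" "poisson_product A A = {0}" "poisson_product B B = {0}"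
  shows "nilpotent (A + B)"
proof (rule cube_zero_imp_nilpotent[OF ideal_set_plus[OF assms(1,2)]])
  note A = idealD[OF assms(1)] and B = idealD[OF assms(2)]
  have zero: "mult x y = 0 \<and> bracket x y = 0" if "x \<in> A \<and> y \<in> A \<or> x \<in> B \<and> y \<in> B" for x y
    using that assms(3,4) by (auto simp: poisson_product_eq_zero_iff)
  have "poisson_product (A + B) (A + B) \<subseteq> A \<inter> B"
  proof (intro poisson_product_subset subspace_inter A B)
    fix x y assume "x \<in> A + B" "y \<in> A + B"
    then obtain a b a' b' where xy: "x = a + b" "y = a' + b'" and
      mem: "a \<in> A" "b \<in> B" "a' \<in> A" "b' \<in> B"
      by (elim set_plus_elim)
    have "mult x y = mult a b' + mult b a'" "bracket x y = bracket a b' + bracket b a'"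
      using mem zero by (simp_all add: xy mult_simps(1,2) bracket_simps(1,2))
    then show "mult x y \<in> A \<inter> B \<and> bracket x y \<in> A \<inter> B"
      using mem A B by (auto intro: subspace_add)
  qed
  then show "mult x y = 0 \<and> bracket x y = 0"
    if "x \<in> A + B" "y \<in> poisson_product (A + B) (A + B)" for x y
    using that zero by (auto elim!: set_plus_elim simp: mult_simps(1) bracket_simps(1) subset_iff)
qed

end

locale finite_dimensional_poisson_algebra =
  poisson_algebra scale bracket mult + finite_dimensional_vector_space scale Basis
  for scale :: "'f::field \<Rightarrow> 'v::ab_group_add \<Rightarrow> 'v"
    and bracket mult :: "'v \<Rightarrow> 'v \<Rightarrow> 'v" and Basis :: "'v set"
begin

text \<open>
  Nilpotent ideals of a \<open>\<phi>\<close>-free algebra have square zero, and sums of square-zero ideals are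
  nilpotent; so a nilpotent ideal of maximal dimension absorbs every other one.
\<close>
lemma phi_free_nilradical:
  assumes "phi_free"
  shows "ideal nilradical" "poisson_product nilradical nilradical = {0}"
    "\<And>I. ideal I \<Longrightarrow> nilpotent I \<Longrightarrow> I \<subseteq> nilradical"
proof -
  let ?P = "\<lambda>I. ideal I \<and> nilpotent I"
  have zero: "ideal {0}" "nilpotent {0}"
    by (auto simp: ideal_iff mult_simps bracket_simps nilpotent_def intro: exI[of _ 1])
  have bounded: "dim I \<le> dimension" for I
    by (rule dim_subset_UNIV)
  obtain N where N: "?P N" and max: "\<And>I. ?P I \<Longrightarrow> dim I \<le> dim N"
    using ex_has_greatest_nat[of ?P "{0}" dim "Suc dimension"] zero bounded by (auto simp: less_Suc_eq_le)
  have square: "poisson_product I I = {0}" if "?P I" for I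
    using phi_free_nilpotent_ideal_square_zero[OF assms] that by blast
  have absorbs: "I \<subseteq> N" if I: "?P I" for I
  proof -
    have "?P (N + I)"
      using N I square by (intro conjI ideal_set_plus sum_of_square_zero_ideals_nilpotent) auto
    moreover have sub: "N \<subseteq> N + I" "I \<subseteq> N + I"
      using N I idealD(1) by (auto intro!: subset_set_plus_left subset_set_plus_right)
    ultimately have "N = N + I"
      using max N idealD(1) by (intro subspace_dim_equal) auto
    with sub show ?thesis
      by simp
  qed
  then have "nilradical = N"
    unfolding nilradical_def using N by (intro Greatest_equality) auto
  then show "ideal nilradical" "poisson_product nilradical nilradical = {0}"
    "\<And>I. ideal I \<Longrightarrow> nilpotent I \<Longrightarrow> I \<subseteq> nilradical"
    using N absorbs square by auto
qed

text \<open>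
  A subalgebra \<open>U\<close> of least dimension that supplements \<open>A\<close> is a complement: \<open>A \<inter> U\<close> is stable
  under \<open>U\<close> and annihilated by \<open>A\<close>, hence an ideal, and a maximal subalgebra \<open>M\<close> missing it
  would leave the smaller supplement \<open>M \<inter> U\<close>.
\<close>
lemma phi_free_square_zero_ideal_complemented:
  assumes "phi_free" "ideal A" "poisson_product A A = {0}"
  obtains U where "subalgebra U" "A + U = UNIV" "A \<inter> U = {0}"
proof -
  note A = idealD[OF assms(2)]
  let ?P = "\<lambda>U. subalgebra U \<and> A + U = UNIV"
  have "?P UNIV"
    using subset_set_plus_right[OF A(1), of UNIV] by (auto simp: subalgebra_def)
  then obtain U where U: "?P U" and min: "\<And>V. ?P V \<Longrightarrow> dim U \<le> dim V"
    using ex_has_least_nat[of ?P UNIV dim] by blast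
  note U' = subalgebraD[OF conjunct1[OF U]]
  have ideal: "ideal (A \<inter> U)"
    unfolding ideal_iff
  proof (intro conjI ballI allI)
    show "subspace (A \<inter> U)"
      by (intro subspace_inter A U')
    fix x y assume x: "x \<in> A \<inter> U"
    obtain a u where "y = a + u" "a \<in> A" "u \<in> U"
      using U by (metis UNIV_I set_plus_elim)
    then have "mult x y = mult x u" "bracket x y = bracket x u"
      using x assms(3) by (auto simp: poisson_product_eq_zero_iff mult_simps bracket_simps)
    with x \<open>u \<in> U\<close> show "mult x y \<in> A \<inter> U" "bracket x y \<in> A \<inter> U"
      using A U' by auto
  qed
  have "A \<inter> U \<subseteq> frattini_subalgebra"
    unfolding frattini_subalgebra_def
  proof (intro Inter_greatest, rule ccontr)
    fix M assume "M \<in> {M. maximal_subalgebra M}" and missed: "\<not> A \<inter> U \<subseteq> M"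
    then have M: "maximal_subalgebra M"
      by simp
    then have M': "subalgebra M" "A \<inter> U + M = UNIV"
      using maximal_subalgebra_supplement[OF M ideal missed] by (auto simp: maximal_subalgebra_def)
    have sub: "subalgebra (M \<inter> U)"
      using M'(1) U by (auto simp: subalgebra_def subspace_inter)
    have "v \<in> A + (M \<inter> U)" for v
    proof -
      obtain a u where v: "v = a + u" "a \<in> A" "u \<in> U"
        using U by (metis UNIV_I set_plus_elim)
      obtain b m where u: "u = b + m" "b \<in> A \<inter> U" "m \<in> M"
        using M'(2) by (metis UNIV_I set_plus_elim)
      then have "m = u - b"
        by simp
      then have "m \<in> M \<inter> U"
        using u v subspace_diff[OF U'(1)] by blast
      moreover have "a + b \<in> A"
        using u v A by (auto intro: subspace_add)
      ultimately show ?thesis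
        unfolding v u add.assoc[symmetric] by (intro set_plus_intro)
    qed
    then have "dim U \<le> dim (M \<inter> U)"
      using min sub by blast
    then have "M \<inter> U = U"
      using sub U'(1) by (intro subspace_dim_equal) (auto simp: subalgebra_def)
    with missed show False
      by blast
  qed
  then have "A \<inter> U = {0}"
    by (rule phi_free_imp_ideal_zero[OF assms(1) ideal])
  with U that show thesis
    by blast
qed

text \<open>
  Complete reducibility of \<open>N\<close>: for a complement \<open>U\<close> of \<open>K\<close>, the subspace \<open>N \<inter> U\<close> is stable under
  \<open>U\<close> and annihilated by \<open>K\<close>, hence an ideal.
\<close>
lemma phi_free_ideal_in_square_zero_ideal_complemented:
  assumes "phi_free" "ideal N" "poisson_product N N = {0}" "ideal K" "K \<subseteq> N"
  obtains K' where "ideal K'" "K' \<subseteq> N" "K + K' = N" "K \<inter> K' = {0}"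
proof -
  note N = idealD[OF assms(2)]
  have zero: "mult x y = 0" "bracket x y = 0" if "x \<in> N" "y \<in> N" for x y
    using that assms(3) by (auto simp: poisson_product_eq_zero_iff)
  have "poisson_product K K = {0}"
    using assms(3,5) unfolding poisson_product_eq_zero_iff by blast
  then obtain U where U: "subalgebra U" "K + U = UNIV" "K \<inter> U = {0}"
    using phi_free_square_zero_ideal_complemented[OF assms(1,4)] by blast
  note U' = subalgebraD[OF U(1)]
  have "ideal (N \<inter> U)"
    unfolding ideal_iff
  proof (intro conjI ballI allI)
    show "subspace (N \<inter> U)"
      by (intro subspace_inter N U')
    fix x y assume x: "x \<in> N \<inter> U"
    obtain a u where "y = a + u" "a \<in> K" "u \<in> U"
      using U by (metis UNIV_I set_plus_elim)
    moreover from this have "mult x a = 0" "bracket x a = 0"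
      using x assms(5) zero by auto
    ultimately show "mult x y \<in> N \<inter> U" "bracket x y \<in> N \<inter> U"
      using x N U' by (auto simp: mult_simps(2) bracket_simps(2))
  qed
  moreover have "K + (N \<inter> U) = N"
  proof
    show "K + (N \<inter> U) \<subseteq> N"
      using assms(5) by (intro set_plus_subset N) auto
    show "N \<subseteq> K + (N \<inter> U)"
    proof
      fix n assume n: "n \<in> N"
      obtain a u where au: "n = a + u" "a \<in> K" "u \<in> U"
        using U by (metis UNIV_I set_plus_elim)
      then have "u = n - a"
        by simp
      then have "u \<in> N"
        using n au(2) assms(5) subspace_diff[OF N(1)] by blast
      with au show "n \<in> K + (N \<inter> U)"
        by auto
    qed
  qed
  moreover have "K \<inter> (N \<inter> U) = {0}"
    using U(3) subspace_0[OF N(1)] by auto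
  ultimately show thesis
    using that by blast
qed

end

section \<open>Solvable algebras in characteristic zero\<close>

context finite_dimensional_poisson_algebra
begin

lemma linear_bracket: "Vector_Spaces.linear scale scale (bracket x)"
  using bilinear_bracket by (simp add: bilinear_op_def)

lemma commutator_bracket_nilpotent:
  assumes char: "CHAR('f) = 0" and N: "ideal N" "poisson_product N N = {0}"
    and "bracket a (bracket x a) \<in> N"
  shows "\<exists>k. \<forall>v\<in>N. (bracket (bracket x a) ^^ k) v = 0"
proof (rule commutator_nilpotent[OF char linear_bracket[of a] linear_bracket[of x] linear_bracket
      idealD(1)[OF N(1)]])
  show "bracket a v \<in> N" "bracket x v \<in> N" "bracket (bracket x a) v \<in> N" if "v \<in> N" for v
    using idealD(5)[OF N(1) that] by blast+
  show "bracket x (bracket a v) = bracket a (bracket x v) + bracket (bracket x a) v" for v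
    by (simp add: jacobi_derivation[of x a v] add.commute)
  show "bracket a (bracket (bracket x a) v) = bracket (bracket x a) (bracket a v)" if "v \<in> N" for v
    using assms(4) that N(2)
    by (simp add: jacobi_derivation[of a "bracket x a" v] poisson_product_eq_zero_iff)
qed

text \<open>
  The common kernel \<open>K\<close> of \<open>S\<close> in the nilradical \<open>N\<close> is an ideal. If it were proper, its
  complementary ideal in \<open>N\<close> would contain a further common kernel vector of the commuting
  nilpotent operators from \<open>S\<close>. So \<open>S\<close> annihilates \<open>N\<close>, and its span is an ideal of vanishing cube.
\<close>
lemma ad_nilpotent_set_subset_nilradical:
  assumes phi_free and zero: "\<And>x y. mult x y = 0"
    and S: "\<And>a y. a \<in> S \<Longrightarrow> bracket a y \<in> S"
      "\<And>a b. a \<in> S \<Longrightarrow> b \<in> S \<Longrightarrow> bracket a b \<in> nilradical"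
    and nilpotent: "\<And>a. a \<in> S \<Longrightarrow> \<exists>k. \<forall>v\<in>nilradical. (bracket a ^^ k) v = 0"
  shows "S \<subseteq> nilradical"
proof -
  let ?N = nilradical
  note N = phi_free_nilradical[OF \<open>phi_free\<close>]
  note N' = idealD[OF N(1)]
  have abelian: "bracket x y = 0" if "x \<in> ?N" "y \<in> ?N" for x y
    using that N(2) by (auto simp: poisson_product_eq_zero_iff)
  define K where "K = {v \<in> ?N. \<forall>a\<in>S. bracket a v = 0}"
  have "ideal K"
    unfolding ideal_iff
  proof (intro conjI ballI allI)
    show sub: "subspace K"
      using N'(1) by (auto simp: K_def subspace_def bracket_simps)
    fix v y assume v: "v \<in> K"
    show "mult v y \<in> K"
      using subspace_0[OF sub] by (simp add: zero)
    have "bracket a (bracket v y) = 0" if "a \<in> S" for a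
    proof -
      have "bracket a (bracket v y) = bracket v (bracket a y)"
        using v that by (simp add: jacobi_derivation[of a v y] K_def bracket_simps)
      also have "\<dots> = - bracket (bracket a y) v"
        by (rule bracket_antisym)
      also have "\<dots> = 0"
        using v S(1)[OF that] by (simp add: K_def)
      finally show ?thesis .
    qed
    then show "bracket v y \<in> K"
      using v N'(4) by (simp add: K_def)
  qed
  then obtain K' where K': "ideal K'" "K' \<subseteq> ?N" "K + K' = ?N" "K \<inter> K' = {0}"
    using phi_free_ideal_in_square_zero_ideal_complemented[OF \<open>phi_free\<close> N(1,2), of K]
    by (auto simp: K_def)
  have "K' = {0}"
  proof (rule ccontr)
    assume nz: "K' \<noteq> {0}"
    have "\<exists>v\<in>K'. v \<noteq> 0 \<and> (\<forall>f\<in>bracket ` S. f v = 0)"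
    proof (rule commuting_nilpotents_common_kernel[OF _ idealD(1)[OF K'(1)] nz])
      show "Vector_Spaces.linear scale scale f" if "f \<in> bracket ` S" for f
        using that linear_bracket by blast
      show "f v \<in> K'" if "f \<in> bracket ` S" "v \<in> K'" for f v
        using that idealD(5)[OF K'(1)] by blast
      show "\<exists>k. \<forall>v\<in>K'. (f ^^ k) v = 0" if "f \<in> bracket ` S" for f
        using that nilpotent K'(2) by (metis imageE subsetD)
      fix f g v assume "f \<in> bracket ` S" "g \<in> bracket ` S" "v \<in> K'"
      then obtain a b where "f = bracket a" "g = bracket b" "bracket a b \<in> ?N" "v \<in> ?N"
        using S(2) K'(2) by blast
      then show "f (g v) = g (f v)"
        by (simp add: jacobi_derivation[of a b v] abelian)
    qed
    then show False
      using K' by (auto simp: K_def)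
  qed
  then have kills: "bracket a v = 0" if "a \<in> S" "v \<in> ?N" for a v
    using that K'(3) by (auto simp: K_def)
  let ?J = "span S"
  have "bracket x y \<in> ?J" if "x \<in> ?J" for x y
    using bilinear_op_span_left[OF bilinear_bracket subspace_span span_base[OF S(1)] that] .
  then have J: "ideal ?J"
    by (simp add: ideal_iff zero subspace_span subspace_0[OF subspace_span])
  have "nilpotent ?J"
  proof (rule cube_zero_imp_nilpotent[OF J])
    fix x y assume x: "x \<in> ?J" and y: "y \<in> poisson_product ?J ?J"
    have step: "bracket u b \<in> ?N" if "u \<in> ?J" "b \<in> S" for u b
      using bilinear_op_span_left[OF bilinear_bracket N'(1) S(2)[OF _ that(2)] that(1)] .
    have "bracket u w \<in> ?N" if "u \<in> ?J" "w \<in> ?J" for u w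
      using bilinear_op_span_right[OF bilinear_bracket N'(1) step[OF that(1)] that(2)] .
    then have "poisson_product ?J ?J \<subseteq> ?N"
      by (intro poisson_product_subset N') (simp add: zero subspace_0[OF N'(1)])
    then have "y \<in> ?N"
      using y by blast
    then have "bracket x y \<in> {0}"
      using bilinear_op_span_left[OF bilinear_bracket subspace_single_0 _ x] kills by blast
    then show "mult x y = 0 \<and> bracket x y = 0"
      by (simp add: zero)
  qed
  then show ?thesis
    using N(3)[OF J] span_superset by blast
qed

text \<open>
  In characteristic zero the elements of \<open>A\<close> that act nilpotently on the nilradical are stable
  under bracketing with the whole algebra: \<open>[x, b]\<close> and \<open>b\<close> lie in \<open>A\<close>, so they commute on the
  nilradical and Jacobson's lemma makes \<open>[x, b]\<close> nilpotent there.
\<close>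
lemma ad_nilpotent_in_nilradical:
  assumes char: "CHAR('f) = 0" and phi_free and zero: "\<And>x y. mult x y = 0"
    and A: "ideal A" "\<And>x y. x \<in> A \<Longrightarrow> y \<in> A \<Longrightarrow> bracket x y \<in> nilradical"
    and a: "a \<in> A" "\<exists>k. \<forall>v\<in>nilradical. (bracket a ^^ k) v = 0"
  shows "a \<in> nilradical"
proof -
  note N = phi_free_nilradical[OF \<open>phi_free\<close>]
  let ?S = "{a \<in> A. \<exists>k. \<forall>v\<in>nilradical. (bracket a ^^ k) v = 0}"
  have "?S \<subseteq> nilradical"
  proof (rule ad_nilpotent_set_subset_nilradical[OF \<open>phi_free\<close> zero])
    fix b y assume b: "b \<in> ?S"
    \<comment> \<open>Jacobson's lemma speaks of brackets with \<open>b\<close> on the right.\<close>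
    have eq: "bracket b y = bracket (- y) b"
      by (simp add: bracket_simps(7) bracket_antisym[of y b])
    have "bracket b (bracket (- y) b) \<in> nilradical"
      using b A by (simp add: eq[symmetric] idealD(4)[OF A(1)])
    then show "bracket b y \<in> ?S"
      using commutator_bracket_nilpotent[OF char N(1,2)] b idealD(5)[OF A(1)] by (simp add: eq)
  qed (use A in auto)
  with a show ?thesis
    by blast
qed

text \<open>
  Ascent along the derived series inside the ideal \<open>Z\<close> of elements central modulo the
  nilradical \<open>N\<close>: if \<open>[C, C] \<subseteq> Z\<close>, Jacobson's lemma makes every commutator of \<open>C\<close> act
  nilpotently on \<open>N\<close>, so that \<open>[C, C] \<subseteq> N\<close>. For an ideal \<open>C\<close> with \<open>[C, C] \<subseteq> N\<close> the same lemma
  applies to \<open>[x, c]\<close> with \<open>c \<in> C\<close>, and gives \<open>C \<subseteq> Z\<close>.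
\<close>
lemma phi_free_solvable_derived_in_nilradical:
  assumes char: "CHAR('f) = 0" and phi_free and "solvable UNIV"
  shows "bracket x y \<in> nilradical"
proof -
  have zero: "mult x y = 0" for x y
    by (rule phi_free_solvable_imp_mult_zero[OF assms(2,3)])
  let ?N = nilradical
  note N = phi_free_nilradical[OF \<open>phi_free\<close>]
  note N' = idealD[OF N(1)]
  note nilpotent = commutator_bracket_nilpotent[OF char N(1,2)]
  note in_N = ad_nilpotent_in_nilradical[OF char \<open>phi_free\<close> zero]
  define Z where "Z = {z. \<forall>x. bracket x z \<in> ?N}"
  have NZ: "?N \<subseteq> Z"
    using N'(5) by (auto simp: Z_def)
  have ZN: "bracket z y \<in> ?N" "bracket y z \<in> ?N" if "z \<in> Z" for z y
    using that subspace_neg[OF N'(1)] by (auto simp: Z_def bracket_antisym[of z y])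
  have "subspace Z"
    using N'(1) by (auto simp: Z_def subspace_def bracket_simps)
  then have Z: "ideal Z"
    using ZN NZ by (auto simp: ideal_iff zero subspace_0)
  have central: "C \<subseteq> Z" if C: "ideal C" "\<And>x y. x \<in> C \<Longrightarrow> y \<in> C \<Longrightarrow> bracket x y \<in> ?N" for C
  proof
    fix c assume c: "c \<in> C"
    have "bracket x c \<in> ?N" for x
    proof (rule in_N[OF C])
      show xc: "bracket x c \<in> C"
        using idealD(5)[OF C(1) c] .
      show "\<exists>k. \<forall>v\<in>?N. (bracket (bracket x c) ^^ k) v = 0"
        by (rule nilpotent) (rule C(2)[OF c xc])
    qed
    then show "c \<in> Z"
      by (simp add: Z_def)
  qed
  have ideal: "ideal (derived UNIV n)" for n
    by (induction n) (simp_all add: ideal_poisson_square, simp add: ideal_iff)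
  have step: "derived UNIV n \<subseteq> Z" if sub: "derived UNIV (Suc n) \<subseteq> Z" for n
  proof (rule central[OF ideal])
    fix x y assume "x \<in> derived UNIV n" "y \<in> derived UNIV n"
    then have z: "bracket x y \<in> Z"
      using sub poisson_product_memI(2) by (auto simp: subset_iff)
    show "bracket x y \<in> ?N"
    proof (rule in_N[OF Z ZN(1) z])
      show "\<exists>k. \<forall>v\<in>?N. (bracket (bracket x y) ^^ k) v = 0"
        by (rule nilpotent) (rule ZN(2)[OF z])
    qed
  qed
  obtain m where "derived UNIV m = {0}"
    using \<open>solvable UNIV\<close> by (auto simp: solvable_def)
  then have "derived UNIV m \<subseteq> Z"
    using subspace_0[OF \<open>subspace Z\<close>] by simp
  then have "derived UNIV 0 \<subseteq> Z"
    by (induction m) (use step in blast)+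
  then have "y \<in> Z"
    by auto
  then show ?thesis
    by (rule ZN(2))
qed

end

section \<open>The structure theorem\<close>

theorem corollary4p6:
  fixes scale :: "'f::field \<Rightarrow> 'v::ab_group_add \<Rightarrow> 'v"
    and bracket mult :: "'v \<Rightarrow> 'v \<Rightarrow> 'v"
    and N :: "'v set"
  assumes "poisson_algebra scale bracket mult"
    and "\<exists>Basis. finite_dimensional_vector_space scale Basis"
    and "poisson_algebra.solvable scale bracket mult UNIV"
    and "N = poisson_algebra.nilradical scale bracket mult"
  shows "(poisson_algebra.phi_free scale bracket mult \<longleftrightarrow>
      (\<exists>U. poisson_algebra.subalgebra scale bracket mult U \<and>
           N + U = UNIV \<and> N \<inter> U = {0} \<and>
           vector_space.set_product scale mult UNIV UNIV = {0} \<and>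
           lie_algebra.lie_phi_free scale bracket \<and>
           lie_algebra.lie_solvable scale bracket UNIV)) \<and>
    (CHAR('f) = 0 \<longrightarrow> poisson_algebra.phi_free scale bracket mult \<longrightarrow>
      (\<forall>U. poisson_algebra.subalgebra scale bracket mult U \<and>
           N + U = UNIV \<and> N \<inter> U = {0} \<longrightarrow>
           poisson_algebra.poisson_product scale bracket mult U U = {0}))"
proof -
  obtain Basis where "finite_dimensional_vector_space scale Basis"
    using assms(2) by blast
  with assms(1) interpret finite_dimensional_poisson_algebra scale bracket mult Basis
    by (rule finite_dimensional_poisson_algebra.intro)
  show ?thesis
  proof (intro conjI iffI impI allI)
    assume free: phi_free
    have zero: "mult x y = 0" for x y
      by (rule phi_free_solvable_imp_mult_zero[OF free assms(3)])
    then have "set_product mult UNIV UNIV \<subseteq> {0}"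
      by (intro set_product_subset) simp_all
    then have "set_product mult UNIV UNIV = {0}"
      using subspace_0[OF subspace_set_product] by blast
    moreover obtain U where "subalgebra U" "N + U = UNIV" "N \<inter> U = {0}"
      using phi_free_square_zero_ideal_complemented[OF free phi_free_nilradical(1,2)[OF free]]
        assms(4) by metis
    ultimately show "\<exists>U. subalgebra U \<and> N + U = UNIV \<and> N \<inter> U = {0} \<and>
        set_product mult UNIV UNIV = {0} \<and> lie_phi_free \<and> lie_solvable UNIV"
      using free assms(3) mult_zero_imp_notions_agree[OF zero] by blast
  next
    assume "\<exists>U. subalgebra U \<and> N + U = UNIV \<and> N \<inter> U = {0} \<and>
        set_product mult UNIV UNIV = {0} \<and> lie_phi_free \<and> lie_solvable UNIV"
    then have "set_product mult UNIV UNIV = {0}" and "lie_phi_free"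
      by auto
    moreover from this have "mult x y = 0" for x y
      using set_product_memI[of x UNIV y UNIV mult] by simp
    ultimately show phi_free
      using mult_zero_imp_notions_agree(1) by blast
  next
    fix U assume char: "CHAR('f) = 0" and free: phi_free
      and U: "subalgebra U \<and> N + U = UNIV \<and> N \<inter> U = {0}"
    have "bracket x y \<in> N \<inter> U" if "x \<in> U" "y \<in> U" for x y
      using phi_free_solvable_derived_in_nilradical[OF char free assms(3)] that U assms(4)
        subalgebraD(3)[of U] by blast
    then show "poisson_product U U = {0}"
      using U phi_free_solvable_imp_mult_zero[OF free assms(3)]
      by (simp add: poisson_product_eq_zero_iff)
  qed
qed

end
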